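(* Let $(X,d)$ be a compact metric space, let $f:X\to X$ be continuous and let $\varepsilon>0$. If the induced map $\overline f:\mathcal K(X)\to\mathcal K(X)$ is generically $\varepsilon$-chaotic, then $f$ is generically $\varepsilon$-chaotic.
   Context: For a compact metric space $(X,d)$, $\mathcal K(X)$ denotes the set of all non-empty compact subsets of $X$ with the Hausdorff metric $d_H$ (a compact metric space). A continuous map $f:X\to X$ induces the continuous map $\overline f:\mathcal K(X)\to\mathcal K(X)$, $\overline f(K)=f(K)=\{f(x): x\in K\}$. For a continuous map $g:Y\to Y$ of a compact metric space $(Y,\rho)$ and $\varepsilon>0$, let $C(g,\varepsilon)$ be the set of pairs $(x,y)\in Y^2$ with $\liminf_{n\to\infty}\rho(g^n(x),g^n(y))=0$ and $\limsup_{n\to\infty}\rho(g^n(x),g^n(y))>\varepsilon$. The map $g$ is generically $\varepsilon$-chaotic if $C(g,\varepsilon)$ is residual in $Y^2$ (i.e. its complement is of first category: a countable union of nowhere dense sets). For $\overline f$ this is applied with $Y=\mathcal K(X)$, $\rho=d_H$. *)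

theory Defs
  imports "HOL-Analysis.Analysis"
begin

section \<open>The hyperspace of non-empty compact subsets\<close>

definition compact_subsets :: "'a set \<Rightarrow> ('a \<Rightarrow> 'a \<Rightarrow> real) \<Rightarrow> 'a set set" where
  "compact_subsets X d = {K. compactin (Metric_space.mtopology X d) K \<and> K \<noteq> {}}"

text \<open>The locale \<^locale>\<open>Metric_space\<close> demands a distance that is non-negative on the whole
  type, whereas a real supremum is unspecified on empty or unbounded sets. The value \<open>0\<close>
  outside the compact subsets is only there for that reason.\<close>

definition hausdorff_dist :: "'a set \<Rightarrow> ('a \<Rightarrow> 'a \<Rightarrow> real) \<Rightarrow> 'a set \<Rightarrow> 'a set \<Rightarrow> real" where
  "hausdorff_dist X d A B =
     (if A \<in> compact_subsets X d \<and> B \<in> compact_subsets X d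
      then max (SUP x\<in>A. INF y\<in>B. d x y) (SUP y\<in>B. INF x\<in>A. d x y)
      else 0)"

text \<open>\<^const>\<open>Metric_space.mtopology\<close> is characterised only on metric spaces, hence
  the following lemma is what gives its use on the hyperspace the intended meaning.\<close>

lemma Metric_space_compact_subsets:
  assumes "Metric_space X d"
  shows "Metric_space (compact_subsets X d) (hausdorff_dist X d)"
proof -
  interpret Metric_space X d by fact
  define e where "e A B = (SUP x\<in>A. INF y\<in>B. d x y)" for A B
  let ?K = "compact_subsets X d"
  have H: "hausdorff_dist X d A B = (if A \<in> ?K \<and> B \<in> ?K then max (e A B) (e B A) else 0)" for A B
    unfolding hausdorff_dist_def e_def by (simp add: commute)
  have sub: "A \<subseteq> X" and ne: "A \<noteq> {}" and cl: "closedin mtopology A" if "A \<in> ?K" for A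
    using that compactin_subset_topspace[of mtopology A]
      compactin_imp_closedin[OF Hausdorff_space_mtopology, of A]
    by (auto simp: compact_subsets_def)
  have bb: "bdd_below ((\<lambda>y. d x y) ` B)" for x B
    by (rule bdd_belowI[of _ 0]) auto
  have inf_le: "(INF y\<in>B. d x y) \<le> d x y" if "y \<in> B" for x y B
    by (rule cINF_lower[OF bb that])
  have inf_nn: "0 \<le> (INF y\<in>B. d x y)" if "B \<noteq> {}" for x B
    by (rule cINF_greatest[OF that]) auto
  have ba: "bdd_above ((\<lambda>x. INF y\<in>B. d x y) ` A)" if A: "A \<in> ?K" and B: "B \<in> ?K" for A B
  proof -
    have "mbounded (A \<union> B)"
      using A B by (simp add: compact_subsets_def compactin_imp_mbounded mbounded_Un)
    then obtain C where C: "\<And>x y. x \<in> A \<union> B \<Longrightarrow> y \<in> A \<union> B \<Longrightarrow> d x y \<le> C"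
      unfolding mbounded_alt by blast
    obtain b where b: "b \<in> B" using ne[OF B] by blast
    show ?thesis
    proof (rule bdd_aboveI2)
      show "(INF y\<in>B. d x y) \<le> C" if "x \<in> A" for x
        using inf_le[OF b, of x] C[of x b] that b by simp
    qed
  qed
  have le_e: "(INF y\<in>B. d x y) \<le> e A B" if "A \<in> ?K" "B \<in> ?K" "x \<in> A" for A B x
    unfolding e_def by (rule cSUP_upper[OF that(3) ba[OF that(1,2)]])
  have nn: "0 \<le> e A B" if A: "A \<in> ?K" and B: "B \<in> ?K" for A B
  proof -
    obtain a where "a \<in> A" using ne[OF A] by blast
    then show ?thesis using le_e[OF A B, of a] inf_nn[OF ne[OF B], of a] by linarith
  qed
  have refl: "e A A = 0" if A: "A \<in> ?K" for A
  proof (rule antisym[OF _ nn[OF A A]])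
    show "e A A \<le> 0"
      unfolding e_def
    proof (rule cSUP_least[OF ne[OF A]])
      fix x assume "x \<in> A"
      then show "(INF y\<in>A. d x y) \<le> 0"
        using inf_le[of x A x] sub[OF A] by auto
    qed
  qed
  have zero_sub: "A \<subseteq> B" if A: "A \<in> ?K" and B: "B \<in> ?K" and z: "e A B \<le> 0" for A B
  proof
    fix x assume x: "x \<in> A"
    have xX: "x \<in> X" using x sub[OF A] by blast
    have le0: "(INF y\<in>B. d x y) \<le> 0" using le_e[OF A B x] z by linarith
    have "\<exists>y\<in>B. y \<in> mball x r" if "0 < r" for r
    proof -
      have "(INF y\<in>B. d x y) < r" using le0 that by linarith
      then obtain y where "y \<in> B" "d x y < r"
        using cINF_less_iff[OF ne[OF B] bb] by blast
      then show ?thesis using xX sub[OF B] by (auto simp: in_mball)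
    qed
    then have "x \<in> mtopology closure_of B"
      using xX by (auto simp: metric_closure_of)
    then show "x \<in> B" using cl[OF B] by (simp add: closure_of_closedin)
  qed
  have tri: "e A C \<le> e A B + e B C" if A: "A \<in> ?K" and B: "B \<in> ?K" and C: "C \<in> ?K" for A B C
    unfolding e_def[of A C]
  proof (rule cSUP_least[OF ne[OF A]])
    fix x assume x: "x \<in> A"
    have "(INF z\<in>C. d x z) - e B C \<le> (INF y\<in>B. d x y)"
    proof (rule cINF_greatest[OF ne[OF B]])
      fix y assume y: "y \<in> B"
      have "(INF z\<in>C. d x z) - d x y \<le> (INF z\<in>C. d y z)"
      proof (rule cINF_greatest[OF ne[OF C]])
        fix z assume z: "z \<in> C"
        then show "(INF z\<in>C. d x z) - d x y \<le> d y z"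
          using inf_le[OF z, of x] triangle[of x y z] x y sub[OF A] sub[OF B] sub[OF C]
          by (smt (verit) in_mono)
      qed
      then show "(INF z\<in>C. d x z) - e B C \<le> d x y"
        using le_e[OF B C y] by linarith
    qed
    then show "(INF z\<in>C. d x z) \<le> e A B + e B C"
      using le_e[OF A B x] by linarith
  qed
  show ?thesis
  proof
    fix A B
    show "0 \<le> hausdorff_dist X d A B"
      using nn by (auto simp: H le_max_iff_disj)
    show "hausdorff_dist X d A B = hausdorff_dist X d B A"
      by (auto simp: H max.commute)
  next
    fix A B assume AB: "A \<in> ?K" "B \<in> ?K"
    show "hausdorff_dist X d A B = 0 \<longleftrightarrow> A = B"
      using AB zero_sub[OF AB] zero_sub[OF AB(2,1)] refl[OF AB(1)] by (auto simp: H max_def split: if_splits)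
  next
    fix A B C assume ABC: "A \<in> ?K" "B \<in> ?K" "C \<in> ?K"
    then show "hausdorff_dist X d A C \<le> hausdorff_dist X d A B + hausdorff_dist X d B C"
      using tri[of A B C] tri[of C B A] by (simp add: H) linarith
  qed
qed

section \<open>Baire category\<close>

definition nowhere_dense_in :: "'a topology \<Rightarrow> 'a set \<Rightarrow> bool" where
  "nowhere_dense_in T S \<longleftrightarrow> S \<subseteq> topspace T \<and> T interior_of (T closure_of S) = {}"

definition first_category_in :: "'a topology \<Rightarrow> 'a set \<Rightarrow> bool" where
  "first_category_in T S \<longleftrightarrow>
     (\<exists>\<N>. countable \<N> \<and> (\<forall>N\<in>\<N>. nowhere_dense_in T N) \<and> S = \<Union>\<N>)"

definition residual_in :: "'a topology \<Rightarrow> 'a set \<Rightarrow> bool" where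
  "residual_in T S \<longleftrightarrow> S \<subseteq> topspace T \<and> first_category_in T (topspace T - S)"

section \<open>Generic chaos\<close>

text \<open>Lower and upper limits are taken in \<^typ>\<open>ereal\<close>, because the library's
  \<^const>\<open>Liminf\<close> and \<^const>\<open>Limsup\<close> live in complete lattices.\<close>

definition chaotic_pairs ::
  "'a set \<Rightarrow> ('a \<Rightarrow> 'a \<Rightarrow> real) \<Rightarrow> ('a \<Rightarrow> 'a) \<Rightarrow> real \<Rightarrow> ('a \<times> 'a) set" where
  "chaotic_pairs Y \<rho> g \<epsilon> =
     {(x, y). x \<in> Y \<and> y \<in> Y \<and>
        liminf (\<lambda>n. ereal (\<rho> ((g ^^ n) x) ((g ^^ n) y))) = 0 \<and>
        limsup (\<lambda>n. ereal (\<rho> ((g ^^ n) x) ((g ^^ n) y))) > ereal \<epsilon>}"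

definition generically_chaotic ::
  "'a set \<Rightarrow> ('a \<Rightarrow> 'a \<Rightarrow> real) \<Rightarrow> ('a \<Rightarrow> 'a) \<Rightarrow> real \<Rightarrow> bool" where
  "generically_chaotic Y \<rho> g \<epsilon> \<longleftrightarrow>
     residual_in (prod_topology (Metric_space.mtopology Y \<rho>) (Metric_space.mtopology Y \<rho>))
       (chaotic_pairs Y \<rho> g \<epsilon>)"

end

theory Submission
  imports Defs
begin

text \<open>Write \<open>K(X)\<close> for the hyperspace, which is complete, so that Baire's theorem applies to its
  square. Proximality passes from a pair of compact sets to a pair of their points: if \<open>f\<^sup>n(K)\<close> and
  \<open>f\<^sup>n(L)\<close> are close, every \<open>x \<in> K\<close> has a \<open>y \<in> L\<close> with \<open>f\<^sup>n(x)\<close> and \<open>f\<^sup>n(y)\<close> close.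

  For the upper limit suppose that no \<open>c > \<epsilon>\<close> and no box inside some open \<open>W \<subseteq> X \<times> X\<close> are such that
  the pairs with \<open>d(f\<^sup>n(x), f\<^sup>n(y)) > c\<close> for some \<open>n \<ge> N\<close> are dense in the box for every \<open>N\<close>. Then
  every box inside \<open>W\<close> contains a smaller one on which \<open>d(f\<^sup>n(x), f\<^sup>n(y)) \<le> c\<close> from some \<open>N\<close> on.
  A pair \<open>(K, L)\<close> near a pair of singletons is approximated by finite sets; shrinking the boxes
  around all the pairs of their points one after the other yields an open set of pairs near
  \<open>(K, L)\<close> whose images eventually have Hausdorff distance at most \<open>c\<close>. So, on an open set,
  generic pairs of compact sets have upper limit at most \<open>\<epsilon>\<close>, a contradiction.\<close>

section \<open>Baire category\<close>

text \<open>An open set misses S exactly when it misses the closure of S. In this form later proofs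
  exhibit a smaller open set instead of computing closures.\<close>

lemma nowhere_dense_in_iff:
  "nowhere_dense_in T S \<longleftrightarrow> S \<subseteq> topspace T \<and>
     (\<forall>W. openin T W \<and> W \<noteq> {} \<longrightarrow> (\<exists>W'. openin T W' \<and> W' \<noteq> {} \<and> W' \<subseteq> W \<and> W' \<inter> S = {}))"
proof -
  have "T interior_of (T closure_of S) = {} \<longleftrightarrow>
      (\<forall>W. openin T W \<and> W \<noteq> {} \<longrightarrow> (\<exists>W'. openin T W' \<and> W' \<noteq> {} \<and> W' \<subseteq> W \<and> W' \<inter> S = {}))"
    if S: "S \<subseteq> topspace T"
  proof (intro iffI allI impI)
    fix W assume e: "T interior_of (T closure_of S) = {}" and W: "openin T W \<and> W \<noteq> {}"
    then have "\<not> W \<subseteq> T closure_of S"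
      by (metis interior_of_maximal subset_empty)
    then show "\<exists>W'. openin T W' \<and> W' \<noteq> {} \<and> W' \<subseteq> W \<and> W' \<inter> S = {}"
      using W closure_of_subset[OF S] by (intro exI[of _ "W - T closure_of S"]) (auto intro: openin_diff)
  next
    assume *: "\<forall>W. openin T W \<and> W \<noteq> {} \<longrightarrow> (\<exists>W'. openin T W' \<and> W' \<noteq> {} \<and> W' \<subseteq> W \<and> W' \<inter> S = {})"
    show "T interior_of (T closure_of S) = {}"
    proof (rule ccontr)
      assume "T interior_of (T closure_of S) \<noteq> {}"
      then obtain W' where W': "openin T W'" "W' \<noteq> {}" "W' \<subseteq> T interior_of (T closure_of S)" "W' \<inter> S = {}"
        using *[rule_format, of "T interior_of (T closure_of S)"] by auto
      then have "W' \<inter> T closure_of S = {}"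
        by (simp add: openin_Int_closure_of_eq_empty)
      then show False
        using W' interior_of_subset[of T "T closure_of S"] by blast
    qed
  qed
  then show ?thesis
    unfolding nowhere_dense_in_def by blast
qed

lemma nowhere_dense_in_subset: "nowhere_dense_in T S \<Longrightarrow> S' \<subseteq> S \<Longrightarrow> nowhere_dense_in T S'"
  unfolding nowhere_dense_in_def
  by (metis closure_of_mono interior_of_mono order_trans subset_empty)

lemma nowhere_dense_imp_first_category: "nowhere_dense_in T S \<Longrightarrow> first_category_in T S"
  unfolding first_category_in_def by (intro exI[of _ "{S}"]) simp

lemma first_category_in_UN:
  assumes "countable I" "\<And>i. i \<in> I \<Longrightarrow> first_category_in T (S i)"
  shows "first_category_in T (\<Union>i\<in>I. S i)"
proof -
  obtain \<N> where "\<And>i. i \<in> I \<Longrightarrow> countable (\<N> i) \<and> (\<forall>N\<in>\<N> i. nowhere_dense_in T N) \<and> S i = \<Union>(\<N> i)"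
    using assms(2) unfolding first_category_in_def by metis
  then show ?thesis
    unfolding first_category_in_def using assms(1)
    by (intro exI[of _ "\<Union>i\<in>I. \<N> i"]) auto
qed

lemma first_category_in_Un:
  assumes "first_category_in T A" "first_category_in T B"
  shows "first_category_in T (A \<union> B)"
  using first_category_in_UN[of "{A, B}" T "\<lambda>S. S"] assms by auto

lemma first_category_in_subset:
  assumes "first_category_in T S" "S' \<subseteq> S"
  shows "first_category_in T S'"
proof -
  obtain \<N> where \<N>: "countable \<N>" "\<forall>N\<in>\<N>. nowhere_dense_in T N" "S = \<Union>\<N>"
    using assms(1) unfolding first_category_in_def by blast
  have "S' = \<Union>((\<lambda>N. N \<inter> S') ` \<N>)"
    using \<N>(3) assms(2) by blast
  then show ?thesis
    unfolding first_category_in_def using \<N>(1,2)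
    by (intro exI[of _ "(\<lambda>N. N \<inter> S') ` \<N>"]) (auto intro: nowhere_dense_in_subset)
qed

text \<open>Baire's theorem for the closures of the nowhere dense pieces: their union has empty
  interior and contains W.\<close>

lemma first_category_in_open_eq_empty:
  assumes "completely_metrizable_space T" "first_category_in T S" "openin T W" "W \<subseteq> S"
  shows "W = {}"
proof -
  obtain \<N> where \<N>: "countable \<N>" "\<forall>N\<in>\<N>. nowhere_dense_in T N" "S = \<Union>\<N>"
    using assms(2) unfolding first_category_in_def by blast
  have "T interior_of \<Union>((closure_of) T ` \<N>) = {}"
    using assms(1) \<N> by (intro Baire_category_alt) (auto simp: nowhere_dense_in_def)
  moreover have "N \<subseteq> T closure_of N" if "N \<in> \<N>" for N
    using that \<N>(2) by (auto simp: nowhere_dense_in_def intro: closure_of_subset[THEN subsetD])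
  then have "W \<subseteq> \<Union>((closure_of) T ` \<N>)"
    using assms(4) \<N>(3) by blast
  ultimately show ?thesis
    by (metis interior_of_maximal assms(3) subset_empty)
qed

text \<open>Supplies generic witnesses: an open W without such a point would lie in the first
  category set made of E and the complement of S.\<close>

lemma residual_in_meets_open:
  assumes "completely_metrizable_space T" "residual_in T S" "first_category_in T E" "openin T W" "W \<noteq> {}"
  shows "\<exists>p\<in>W. p \<in> S \<and> p \<notin> E"
proof (rule ccontr)
  assume "\<not> ?thesis"
  then have "W \<subseteq> (topspace T - S) \<union> E"
    using openin_subset[OF assms(4)] by blast
  moreover have "first_category_in T ((topspace T - S) \<union> E)"
    using assms(2,3) by (intro first_category_in_Un) (simp_all add: residual_in_def)
  ultimately show False
    using first_category_in_open_eq_empty assms by blast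
qed

text \<open>Each complement of an open dense set is nowhere dense. An arbitrary countable index type
  permits indexing by pairs.\<close>

lemma first_category_in_diff_INT_open_dense:
  fixes G :: "'i::countable \<Rightarrow> 'a set"
  assumes "\<And>i. openin T (G i)" "\<And>i W. openin T W \<Longrightarrow> W \<noteq> {} \<Longrightarrow> W \<inter> G i \<noteq> {}"
  shows "first_category_in T (topspace T - (\<Inter>i. G i))"
proof -
  have "nowhere_dense_in T (topspace T - G i)" for i
    unfolding nowhere_dense_in_iff
  proof (intro conjI allI impI)
    fix W assume "openin T W \<and> W \<noteq> {}"
    then have "openin T (W \<inter> G i)" "W \<inter> G i \<noteq> {}"
      using assms by (simp_all add: openin_Int)
    then show "\<exists>W'. openin T W' \<and> W' \<noteq> {} \<and> W' \<subseteq> W \<and> W' \<inter> (topspace T - G i) = {}"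
      by blast
  qed auto
  then have "first_category_in T (\<Union>i. topspace T - G i)"
    by (intro first_category_in_UN) (auto intro: nowhere_dense_imp_first_category)
  then show ?thesis
    by (rule first_category_in_subset) auto
qed

text \<open>The open sets on which all \<open>G k N\<close>, for one fixed \<open>k\<close>, are dense cover a dense open set, so
  that no second countability is needed to pass from local to global residuality.\<close>

lemma first_category_in_diff_UN_INT:
  fixes G :: "'i::countable \<Rightarrow> 'j::countable \<Rightarrow> 'a set"
  assumes op: "\<And>k N. openin T (G k N)"
    and dense: "\<And>W. openin T W \<Longrightarrow> W \<noteq> {} \<Longrightarrow>
      \<exists>k W'. openin T W' \<and> W' \<noteq> {} \<and> W' \<subseteq> W \<and> (\<forall>N. W' \<subseteq> T closure_of G k N)"
  shows "first_category_in T (topspace T - (\<Union>k. \<Inter>N. G k N))"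
proof -
  \<comment> \<open>\<open>B k\<close> is the largest open set on which every \<open>G k N\<close>
    is dense.\<close>
  define B where "B k = T interior_of (\<Inter>N. T closure_of G k N)" for k
  have Bmax: "W' \<subseteq> B k" if "openin T W'" "\<forall>N. W' \<subseteq> T closure_of G k N" for W' k
    using that unfolding B_def by (intro interior_of_maximal) auto
  have "nowhere_dense_in T (topspace T - (\<Union>k. B k))"
    unfolding nowhere_dense_in_iff
  proof (intro conjI allI impI)
    fix W assume "openin T W \<and> W \<noteq> {}"
    then obtain k W' where "openin T W'" "W' \<noteq> {}" "W' \<subseteq> W" "W' \<subseteq> B k"
      using dense Bmax by metis
    then show "\<exists>W'. openin T W' \<and> W' \<noteq> {} \<and> W' \<subseteq> W \<and> W' \<inter> (topspace T - (\<Union>k. B k)) = {}"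
      by blast
  qed auto
  \<comment> \<open>The open set \<open>G k N\<close> is dense in \<open>B k\<close>, so it leaves
    out only a nowhere dense part of \<open>B k\<close>.\<close>
  moreover have "nowhere_dense_in T (B k - G k N)" for k N
    unfolding nowhere_dense_in_iff
  proof (intro conjI allI impI)
    fix W assume W: "openin T W \<and> W \<noteq> {}"
    show "\<exists>W'. openin T W' \<and> W' \<noteq> {} \<and> W' \<subseteq> W \<and> W' \<inter> (B k - G k N) = {}"
    proof (cases "W \<inter> B k = {}")
      case False
      have "B k \<subseteq> T closure_of G k N"
        unfolding B_def using interior_of_subset by fastforce
      moreover have "openin T (W \<inter> B k)"
        using W by (simp add: B_def openin_Int)
      ultimately have "W \<inter> B k \<inter> G k N \<noteq> {}"
        using False openin_Int_closure_of_eq_empty[of T "W \<inter> B k" "G k N"] by blast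
      then show ?thesis
        using \<open>openin T (W \<inter> B k)\<close> op by (intro exI[of _ "W \<inter> B k \<inter> G k N"]) auto
    qed (use W in blast)
  next
    show "B k - G k N \<subseteq> topspace T"
      unfolding B_def using interior_of_subset_topspace by fastforce
  qed
  then have "first_category_in T (\<Union>p. B (fst p) - G (fst p) (snd p))"
    by (intro first_category_in_UN) (auto intro: nowhere_dense_imp_first_category)
  ultimately have "first_category_in T
      ((topspace T - (\<Union>k. B k)) \<union> (\<Union>p. B (fst p) - G (fst p) (snd p)))"
    by (intro first_category_in_Un[OF nowhere_dense_imp_first_category])
  \<comment> \<open>A point in none of the intersections lies in no \<open>B k\<close>, or in some
    \<open>B k\<close> but outside some \<open>G k N\<close>.\<close>
  then show ?thesis
    by (rule first_category_in_subset) force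
qed

section \<open>Boxes of equal radii in the square of a metric space\<close>

lemma (in Metric_space) openin_prod_mtopology:
  "openin (prod_topology mtopology mtopology) S \<longleftrightarrow>
     S \<subseteq> M \<times> M \<and> (\<forall>x y. (x, y) \<in> S \<longrightarrow> (\<exists>r>0. mball x r \<times> mball y r \<subseteq> S))"
proof (intro iffI conjI allI impI)
  assume S: "openin (prod_topology mtopology mtopology) S"
  show "S \<subseteq> M \<times> M"
    using openin_subset[OF S] by simp
  fix x y assume "(x, y) \<in> S"
  then obtain U V where UV: "openin mtopology U" "openin mtopology V" "x \<in> U" "y \<in> V" "U \<times> V \<subseteq> S"
    using S unfolding openin_prod_topology_alt by meson
  then obtain r s where "r > 0" "mball x r \<subseteq> U" "s > 0" "mball y s \<subseteq> V"
    by (meson openin_mtopology)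
  then show "\<exists>r>0. mball x r \<times> mball y r \<subseteq> S"
    using UV(5) mball_subset_concentric[of "min r s" r x] mball_subset_concentric[of "min r s" s y]
    by (intro exI[of _ "min r s"]) (auto simp: subset_iff)
next
  assume S: "S \<subseteq> M \<times> M \<and> (\<forall>x y. (x, y) \<in> S \<longrightarrow> (\<exists>r>0. mball x r \<times> mball y r \<subseteq> S))"
  show "openin (prod_topology mtopology mtopology) S"
    unfolding openin_prod_topology_alt
  proof (intro allI impI)
    fix x y assume xy: "(x, y) \<in> S"
    then obtain r where "r > 0" "mball x r \<times> mball y r \<subseteq> S" using S by blast
    then show "\<exists>U V. openin mtopology U \<and> openin mtopology V \<and> x \<in> U \<and> y \<in> V \<and> U \<times> V \<subseteq> S"
      using xy S by (intro exI[of _ "mball x r"] exI[of _ "mball y r"]) auto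
  qed
qed

section \<open>The hyperspace\<close>

context Metric_space
begin

section \<open>The Hausdorff distance in terms of nearby points\<close>

lemma compact_subsetsD:
  assumes "A \<in> compact_subsets M d"
  shows "compactin mtopology A" "A \<subseteq> M" "A \<noteq> {}"
proof -
  show c: "compactin mtopology A" and "A \<noteq> {}"
    using assms by (simp_all add: compact_subsets_def)
  show "A \<subseteq> M"
    using compactin_subset_topspace[OF c] by simp
qed

lemma compact_subsets_finite: "finite A \<Longrightarrow> A \<subseteq> M \<Longrightarrow> A \<noteq> {} \<Longrightarrow> A \<in> compact_subsets M d"
  by (simp add: compact_subsets_def finite_imp_compactin)

text \<open>A point within r bounds the infimum from above, and a supremum of numbers at most r is
  at most r.\<close>

lemma hausdorff_dist_le:
  assumes A: "A \<in> compact_subsets M d" and B: "B \<in> compact_subsets M d"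
    and AB: "\<And>x. x \<in> A \<Longrightarrow> \<exists>y\<in>B. d x y \<le> r" and BA: "\<And>y. y \<in> B \<Longrightarrow> \<exists>x\<in>A. d x y \<le> r"
  shows "hausdorff_dist M d A B \<le> r"
proof -
  have bb: "bdd_below (h ` C)" if "\<And>y. 0 \<le> h y" for C and h :: "'a \<Rightarrow> real"
    using that by (intro bdd_belowI[of _ 0]) auto
  have "(SUP x\<in>A. INF y\<in>B. d x y) \<le> r"
    using AB by (intro cSUP_least compact_subsetsD[OF A]) (meson bb cINF_lower2 nonneg)
  moreover have "(SUP y\<in>B. INF x\<in>A. d x y) \<le> r"
    using BA by (intro cSUP_least compact_subsetsD[OF B]) (meson bb cINF_lower2 nonneg)
  ultimately show ?thesis
    using A B by (simp add: hausdorff_dist_def)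
qed

lemma hausdorff_dist_commute: "hausdorff_dist M d A B = hausdorff_dist M d B A"
  using Metric_space.commute[OF Metric_space_compact_subsets[OF Metric_space_axioms]] .

text \<open>The supremum lies strictly below r, hence so does the infimum at x, and a strict bound
  yields a point whether or not the infimum is attained.\<close>

lemma hausdorff_dist_lessD:
  assumes A: "A \<in> compact_subsets M d" and B: "B \<in> compact_subsets M d"
    and less: "hausdorff_dist M d A B < r" and x: "x \<in> A"
  shows "\<exists>y\<in>B. d x y < r"
proof -
  have bb: "bdd_below (d x ` B)" for x
    by (intro bdd_belowI[of _ 0]) auto
  \<comment> \<open>A real supremum bounds its members only for a bounded family; boundedness comes
    from compactness of A and B.\<close>
  have "mbounded (A \<union> B)"
    using A B by (simp add: compact_subsets_def compactin_imp_mbounded mbounded_Un)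
  then obtain C where C: "\<And>x y. x \<in> A \<union> B \<Longrightarrow> y \<in> A \<union> B \<Longrightarrow> d x y \<le> C"
    unfolding mbounded_alt by blast
  obtain b where b: "b \<in> B" using compact_subsetsD[OF B] by blast
  have "bdd_above ((\<lambda>x. INF y\<in>B. d x y) ` A)"
    using C b by (intro bdd_aboveI2[of _ _ C]) (metis UnCI bb b cINF_lower2)
  then have "(INF y\<in>B. d x y) \<le> (SUP x\<in>A. INF y\<in>B. d x y)"
    by (rule cSUP_upper[OF x])
  also have "\<dots> < r"
    using less A B by (simp add: hausdorff_dist_def)
  finally show ?thesis
    using cINF_less_iff[OF compact_subsetsD(3)[OF B] bb] by blast
qed

text \<open>The limit of a Cauchy sequence of compact sets is the set of points in the closure of
  every tail. Completeness gives access to Baire's theorem on the square of the hyperspace.\<close>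

lemma mcomplete_compact_subsets:
  assumes comp: "compact_space mtopology"
  shows "Metric_space.mcomplete (compact_subsets M d) (hausdorff_dist M d)"
proof -
  interpret H: Metric_space "compact_subsets M d" "hausdorff_dist M d"
    using Metric_space_axioms by (rule Metric_space_compact_subsets)
  show ?thesis
    unfolding H.mcomplete_def
  proof (intro allI impI)
    fix K assume "H.MCauchy K"
    then have Kc: "\<And>n. K n \<in> compact_subsets M d"
      and Cau: "\<And>e. e > 0 \<Longrightarrow> \<exists>N. \<forall>m\<ge>N. \<forall>n\<ge>N. hausdorff_dist M d (K m) (K n) < e"
      by (auto simp: H.MCauchy_def)
    define L where "L = (\<Inter>m. mtopology closure_of (\<Union>n\<in>{m..}. K n))"
    have clL: "closedin mtopology L"
      unfolding L_def by (intro closedin_Inter) auto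
    have near_L: "\<exists>y\<in>L. d x y \<le> e"
      if N: "\<forall>m\<ge>N. \<forall>n\<ge>N. hausdorff_dist M d (K m) (K n) < e" and "n \<ge> N" "x \<in> K n" for N e n x
    proof -
      have xM: "x \<in> M" using that(3) compact_subsetsD[OF Kc] by blast
      \<comment> \<open>One companion of x in each late \<open>K (N + m)\<close> gives a sequence;
        by compactness a subsequence converges, and its limit is the wanted point of L.\<close>
      have "\<exists>y\<in>K (N + m). d x y < e" for m
        using N that by (intro hausdorff_dist_lessD[OF Kc[of n] Kc]) auto
      then obtain y where y: "\<And>m. y m \<in> K (N + m)" "\<And>m. d x (y m) < e" by metis
      have yM: "y m \<in> M" for m using y compact_subsetsD[OF Kc] by blast
      then obtain l s where ls: "l \<in> M" "strict_mono s" "limitin mtopology (y \<circ> s) l sequentially"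
        using comp[unfolded compact_space_sequentially, rule_format, of y] by blast
      have ev: "\<exists>i. i \<ge> m \<and> d (y (s i)) l < r" if "r > 0" for r m
      proof -
        have "\<forall>\<^sub>F i in sequentially. d (y (s i)) l < r"
          using ls(3) that unfolding limitin_metric by (auto elim: eventually_mono)
        then have "\<forall>\<^sub>F i in sequentially. i \<ge> m \<and> d (y (s i)) l < r"
          using eventually_ge_at_top[of m] by eventually_elim simp
        then show ?thesis by (auto simp: eventually_sequentially)
      qed
      have "l \<in> mtopology closure_of (\<Union>n\<in>{m..}. K n)" for m
        unfolding metric_closure_of
      proof (intro CollectI conjI allI impI ls(1))
        fix r :: real assume "0 < r"
        then obtain i where i: "i \<ge> m" "d (y (s i)) l < r" using ev by blast
        have "N + s i \<ge> m"
          using i(1) seq_suble[OF ls(2), of i] by linarith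
        then show "\<exists>z\<in>\<Union>n\<in>{m..}. K n. z \<in> mball l r"
          using i(2) y(1)[of "s i"] yM ls(1)
          by (intro bexI[of _ "y (s i)"]) (auto simp: commute)
      qed
      then have "l \<in> L" by (simp add: L_def)
      moreover have "d x l \<le> e"
      proof (rule field_le_epsilon)
        fix r :: real assume "0 < r"
        then obtain i where "d (y (s i)) l < r" using ev by blast
        then show "d x l \<le> e + r"
          using triangle[OF xM yM ls(1), of "s i"] y(2)[of "s i"] by linarith
      qed
      ultimately show ?thesis by blast
    qed
    have near_K: "\<exists>x\<in>K n. d x y \<le> 2 * e"
      if N: "\<forall>m\<ge>N. \<forall>n\<ge>N. hausdorff_dist M d (K m) (K n) < e"
        and "e > 0" and n: "n \<ge> N" and y: "y \<in> L" for N e n y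
    proof -
      have "y \<in> mtopology closure_of (\<Union>n\<in>{N..}. K n)" using y by (simp add: L_def)
      \<comment> \<open>Two steps of length e: from y to a point w of some late \<open>K m\<close>,
        and from w into \<open>K n\<close>.\<close>
      then obtain m w where m: "m \<ge> N" "w \<in> K m" "w \<in> mball y e"
        using \<open>e > 0\<close> unfolding metric_closure_of by blast
      then obtain x where x: "x \<in> K n" "d w x < e"
        using hausdorff_dist_lessD[OF Kc Kc _ m(2), of n e] N n by blast
      have "x \<in> M" using x compact_subsetsD[OF Kc] by blast
      then have "d y x \<le> 2 * e"
        using x(2) m(3) triangle[of y w x] by auto
      then show ?thesis using x(1) commute by metis
    qed
    \<comment> \<open>The tolerance 1 is arbitrary; any positive one shows that L is
      non-empty.\<close>
    obtain N1 where "\<forall>m\<ge>N1. \<forall>n\<ge>N1. hausdorff_dist M d (K m) (K n) < 1"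
      using Cau[of 1] by auto
    moreover obtain x1 where "x1 \<in> K N1" using compact_subsetsD[OF Kc] by blast
    ultimately have "L \<noteq> {}" using near_L[of N1 1 N1 x1] by auto
    then have Lc: "L \<in> compact_subsets M d"
      using closedin_compact_space[OF comp clL] by (simp add: compact_subsets_def)
    have "limitin H.mtopology K L sequentially"
      unfolding H.limitin_metric eventually_sequentially
    proof (intro conjI allI impI Lc)
      fix e :: real assume e: "0 < e"
      \<comment> \<open>\<open>near_K\<close> loses a factor 2, and e / 3 keeps the final bound
        strictly below e.\<close>
      then obtain N where N: "\<forall>m\<ge>N. \<forall>n\<ge>N. hausdorff_dist M d (K m) (K n) < e / 3"
        using Cau[of "e / 3"] by auto
      have "hausdorff_dist M d (K n) L \<le> 2 * (e / 3)" if n: "n \<ge> N" for n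
      proof (rule hausdorff_dist_le[OF Kc Lc])
        show "\<exists>y\<in>L. d x y \<le> 2 * (e / 3)" if "x \<in> K n" for x
          using near_L[OF N n that] e by force
        show "\<exists>x\<in>K n. d x y \<le> 2 * (e / 3)" if "y \<in> L" for y
          using near_K[OF N _ n that] e by simp
      qed
      then show "\<exists>N. \<forall>n\<ge>N. K n \<in> compact_subsets M d \<and> hausdorff_dist M d (K n) L < e"
        using Kc e by (intro exI[of _ N]) force
    qed
    then show "\<exists>L. limitin H.mtopology K L sequentially" by blast
  qed
qed

end

section \<open>Chaotic pairs\<close>

text \<open>Countably many thresholds suffice by the Archimedean property. For orbit distances this
  turns a zero lower limit into a countable intersection of open conditions.\<close>

lemma liminf_ereal_eq_0_iff:
  fixes a :: "nat \<Rightarrow> real"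
  assumes nn: "\<And>n. 0 \<le> a n"
  shows "liminf (\<lambda>n. ereal (a n)) = 0 \<longleftrightarrow> (\<forall>k N. \<exists>n\<ge>N. a n < inverse (real (Suc k)))"
proof (intro iffI allI)
  fix k N
  assume lim: "liminf (\<lambda>n. ereal (a n)) = 0"
  show "\<exists>n\<ge>N. a n < inverse (real (Suc k))"
  proof (rule ccontr)
    assume "\<not> (\<exists>n\<ge>N. a n < inverse (real (Suc k)))"
    then have "\<forall>\<^sub>F n in sequentially. ereal (inverse (real (Suc k))) \<le> ereal (a n)"
      unfolding eventually_sequentially by (auto intro!: exI[of _ N] simp: not_less)
    then show False
      using lim Liminf_bounded[of "ereal (inverse (real (Suc k)))" "\<lambda>n. ereal (a n)" sequentially]
      by (simp add: zero_ereal_def)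
  qed
next
  assume small: "\<forall>k N. \<exists>n\<ge>N. a n < inverse (real (Suc k))"
  have "0 \<le> liminf (\<lambda>n. ereal (a n))"
    using nn by (intro Liminf_bounded) auto
  moreover have "\<not> 0 < liminf (\<lambda>n. ereal (a n))"
  proof
    assume "0 < liminf (\<lambda>n. ereal (a n))"
    then obtain c where c: "0 < ereal c" "ereal c < liminf (\<lambda>n. ereal (a n))"
      using ereal_dense2 by blast
    then obtain k where k: "inverse (real (Suc k)) < c"
      using reals_Archimedean by auto
    obtain N where "\<forall>n\<ge>N. c < a n"
      using less_LiminfD[OF c(2)] by (auto simp: eventually_sequentially)
    moreover obtain n where "n \<ge> N" "a n < inverse (real (Suc k))"
      using small by blast
    ultimately show False using k by force
  qed
  ultimately show "liminf (\<lambda>n. ereal (a n)) = 0" by simp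
qed

text \<open>The margin is fixed before N: it comes from a real strictly between e and the upper
  limit, and conversely it keeps the upper limit strictly above e. The result is a union of
  intersections as in \<open>first_category_in_diff_UN_INT\<close>.\<close>

lemma less_limsup_ereal_iff:
  fixes a :: "nat \<Rightarrow> real"
  shows "ereal e < limsup (\<lambda>n. ereal (a n)) \<longleftrightarrow> (\<exists>k. \<forall>N. \<exists>n\<ge>N. e + inverse (real (Suc k)) < a n)"
proof
  assume "ereal e < limsup (\<lambda>n. ereal (a n))"
  then obtain c where c: "ereal e < ereal c" "ereal c < limsup (\<lambda>n. ereal (a n))"
    using ereal_dense2 by blast
  then obtain k where k: "inverse (real (Suc k)) < c - e"
    using reals_Archimedean[of "c - e"] by auto
  have "\<exists>n\<ge>N. e + inverse (real (Suc k)) < a n" for N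
  proof (rule ccontr)
    assume *: "\<not> (\<exists>n\<ge>N. e + inverse (real (Suc k)) < a n)"
    have "a n \<le> c" if "n \<ge> N" for n
    proof -
      have "a n \<le> e + inverse (real (Suc k))" using * that by (meson not_less)
      then show ?thesis using k by linarith
    qed
    then have "\<forall>\<^sub>F n in sequentially. ereal (a n) \<le> ereal c"
      unfolding eventually_sequentially by auto
    then show False
      using c(2) Limsup_bounded by (metis not_less)
  qed
  then show "\<exists>k. \<forall>N. \<exists>n\<ge>N. e + inverse (real (Suc k)) < a n" by blast
next
  assume "\<exists>k. \<forall>N. \<exists>n\<ge>N. e + inverse (real (Suc k)) < a n"
  then obtain k where k: "\<And>N. \<exists>n\<ge>N. e + inverse (real (Suc k)) < a n" by blast
  have "\<not> limsup (\<lambda>n. ereal (a n)) < ereal (e + inverse (real (Suc k)))"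
  proof
    assume "limsup (\<lambda>n. ereal (a n)) < ereal (e + inverse (real (Suc k)))"
    then obtain N where N: "\<forall>n\<ge>N. a n < e + inverse (real (Suc k))"
      using Limsup_lessD by (force simp: eventually_sequentially)
    then show False using k[of N] by force
  qed
  moreover have "ereal e < ereal (e + inverse (real (Suc k)))" by simp
  ultimately show "ereal e < limsup (\<lambda>n. ereal (a n))" by (meson less_le_trans not_less)
qed

lemma (in Metric_space) chaotic_pairs_iff:
  "(x, y) \<in> chaotic_pairs M d g \<epsilon> \<longleftrightarrow> x \<in> M \<and> y \<in> M \<and>
     (\<forall>k N. \<exists>n\<ge>N. d ((g ^^ n) x) ((g ^^ n) y) < inverse (real (Suc k))) \<and>
     (\<exists>k. \<forall>N. \<exists>n\<ge>N. \<epsilon> + inverse (real (Suc k)) < d ((g ^^ n) x) ((g ^^ n) y))"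
  unfolding chaotic_pairs_def
  by (simp add: liminf_ereal_eq_0_iff less_limsup_ereal_iff)

section \<open>Iterates of f and of the induced map\<close>

lemma funpow_image:
  fixes f :: "'a \<Rightarrow> 'a"
  shows "((\<lambda>K. f ` K) ^^ n) K = (f ^^ n) ` K"
  by (induction n) (simp_all add: image_comp)

lemma continuous_map_funpow:
  fixes f :: "'a \<Rightarrow> 'a"
  shows "continuous_map T T f \<Longrightarrow> continuous_map T T (f ^^ n)"
proof (induction n)
  case (Suc n)
  then show ?case using continuous_map_compose[of T T "f ^^ n" T f] by (simp add: o_def)
qed (simp add: id_def)

context Metric_space
begin

lemma funpow_image_compact_subsets:
  assumes "continuous_map mtopology mtopology f" "K \<in> compact_subsets M d"
  shows "(f ^^ n) ` K \<in> compact_subsets M d"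
  using image_compactin[OF _ continuous_map_funpow[OF assms(1)]] assms(2)
  by (simp add: compact_subsets_def)

lemma openin_dist_funpow:
  assumes f: "continuous_map mtopology mtopology f" and S: "open S"
  shows "openin (prod_topology mtopology mtopology)
           {(x, y). x \<in> M \<and> y \<in> M \<and> d ((f ^^ n) x) ((f ^^ n) y) \<in> S}"
proof -
  let ?T = "prod_topology mtopology mtopology"
  have "continuous_map ?T mtopology (\<lambda>p. (f ^^ n) (fst p))"
    "continuous_map ?T mtopology (\<lambda>p. (f ^^ n) (snd p))"
    using continuous_map_compose[OF continuous_map_fst continuous_map_funpow[OF f]]
      continuous_map_compose[OF continuous_map_snd continuous_map_funpow[OF f]]
    by (simp_all add: o_def)
  then have "continuous_map ?T euclidean (\<lambda>p. d ((f ^^ n) (fst p)) ((f ^^ n) (snd p)))"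
    using continuous_map_mdist[of ?T "metric (M, d)" "\<lambda>p. (f ^^ n) (fst p)" "\<lambda>p. (f ^^ n) (snd p)"]
    by simp
  then have "openin ?T {p \<in> topspace ?T. d ((f ^^ n) (fst p)) ((f ^^ n) (snd p)) \<in> S}"
    using S by (intro openin_continuous_map_preimage[of ?T euclidean]) auto
  also have "{p \<in> topspace ?T. d ((f ^^ n) (fst p)) ((f ^^ n) (snd p)) \<in> S} =
      {(x, y). x \<in> M \<and> y \<in> M \<and> d ((f ^^ n) x) ((f ^^ n) y) \<in> S}"
    by auto
  finally show ?thesis .
qed

text \<open>\<open>shrink\<close> treats one pair of balls. The pairs from I and J are handled one
  after the other, each time moving two centres and reducing the common radius; balls only get
  smaller, so earlier gains remain. Separate maps a and b allow I and J to overlap.\<close>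

lemma shrink_balls:
  fixes R :: "nat \<Rightarrow> 'a \<Rightarrow> 'a \<Rightarrow> bool"
  assumes shrink: "\<And>x y r. \<lbrakk>r > 0; x \<in> M; y \<in> M; mball x r \<subseteq> U; mball y r \<subseteq> V\<rbrakk> \<Longrightarrow>
      \<exists>x' y' s N. s > 0 \<and> x' \<in> M \<and> y' \<in> M \<and> mball x' s \<subseteq> mball x r \<and> mball y' s \<subseteq> mball y r \<and>
        (\<forall>p\<in>mball x' s. \<forall>q\<in>mball y' s. \<forall>n\<ge>N. R n p q)"
    and fin: "finite I" "finite J" and r: "r > 0"
    and I: "\<And>i. i \<in> I \<Longrightarrow> i \<in> M \<and> mball i r \<subseteq> U" and J: "\<And>j. j \<in> J \<Longrightarrow> j \<in> M \<and> mball j r \<subseteq> V"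
  shows "\<exists>a b s N. s > 0 \<and> (\<forall>i\<in>I. a i \<in> M \<and> mball (a i) s \<subseteq> mball i r) \<and>
      (\<forall>j\<in>J. b j \<in> M \<and> mball (b j) s \<subseteq> mball j r) \<and>
      (\<forall>i\<in>I. \<forall>j\<in>J. \<forall>p\<in>mball (a i) s. \<forall>q\<in>mball (b j) s. \<forall>n\<ge>N. R n p q)"
proof -
  have "\<exists>a b s N. s > 0 \<and> (\<forall>i\<in>I. a i \<in> M \<and> mball (a i) s \<subseteq> mball i r) \<and>
      (\<forall>j\<in>J. b j \<in> M \<and> mball (b j) s \<subseteq> mball j r) \<and>
      (\<forall>(i, j)\<in>S. \<forall>p\<in>mball (a i) s. \<forall>q\<in>mball (b j) s. \<forall>n\<ge>N. R n p q)"
    if "finite S" "S \<subseteq> I \<times> J" for S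
    using that
  proof (induction S rule: finite_induct)
    case empty
    show ?case
      using r I J by (intro exI[of _ "\<lambda>i. i"] exI[of _ r]) auto
  next
    case (insert z S)
    obtain i0 j0 where z: "z = (i0, j0)" by (cases z)
    have ij: "i0 \<in> I" "j0 \<in> J" using insert.prems z by auto
    obtain a b s N where s: "s > 0"
      and a: "\<forall>i\<in>I. a i \<in> M \<and> mball (a i) s \<subseteq> mball i r"
      and b: "\<forall>j\<in>J. b j \<in> M \<and> mball (b j) s \<subseteq> mball j r"
      and R: "\<forall>(i, j)\<in>S. \<forall>p\<in>mball (a i) s. \<forall>q\<in>mball (b j) s. \<forall>n\<ge>N. R n p q"
      using insert.IH[OF order_trans[OF subset_insertI insert.prems]] by (elim exE conjE)
    \<comment> \<open>The current balls still lie in U and V, so \<open>shrink\<close> applies to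
      them.\<close>
    have UV: "a i0 \<in> M" "b j0 \<in> M" "mball (a i0) s \<subseteq> U" "mball (b j0) s \<subseteq> V"
      using a[rule_format, OF ij(1)] b[rule_format, OF ij(2)] I[OF ij(1)] J[OF ij(2)] by blast+
    obtain x y t N' where t: "t > 0" "x \<in> M" "y \<in> M"
      and x: "mball x t \<subseteq> mball (a i0) s" and y: "mball y t \<subseteq> mball (b j0) s"
      and R': "\<forall>p\<in>mball x t. \<forall>q\<in>mball y t. \<forall>n\<ge>N'. R n p q"
      using shrink[OF s UV] by (elim exE conjE)
    \<comment> \<open>Only the centres belonging to i0 and j0 move; the other balls at most lose
      radius.\<close>
    define a' where "a' = a(i0 := x)"
    define b' where "b' = b(j0 := y)"
    define s' where "s' = min s t"
    have conc: "mball c s' \<subseteq> mball c s" "mball c s' \<subseteq> mball c t" for c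
      unfolding s'_def by (rule mball_subset_concentric, simp)+
    have a': "mball (a' i) s' \<subseteq> mball (a i) s" for i
      using conc(1)[of "a i"] order_trans[OF conc(2)[of x] x] by (simp add: a'_def)
    have b': "mball (b' j) s' \<subseteq> mball (b j) s" for j
      using conc(1)[of "b j"] order_trans[OF conc(2)[of y] y] by (simp add: b'_def)
    have "R n p q" if "(i, j) \<in> insert z S" "p \<in> mball (a' i) s'" "q \<in> mball (b' j) s'" "n \<ge> max N N'"
      for i j p q n
    proof (cases "(i, j) = z")
      case True
      then have "p \<in> mball x t" "q \<in> mball y t"
        using that(2,3) conc(2) by (simp_all only: z a'_def b'_def prod.inject fun_upd_same subset_iff)
      then show ?thesis using R' that(4) by simp
    next
      case False
      \<comment> \<open>Even if i = i0 or j = j0, the new ball lies inside the old one, so the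
        earlier bound survives.\<close>
      then have "(i, j) \<in> S" "p \<in> mball (a i) s" "q \<in> mball (b j) s" "n \<ge> N"
        using that a' b' by (simp_all only: insert_iff subset_iff max.bounded_iff simp_thms)
      then show ?thesis using R by blast
    qed
    moreover have "s' > 0" using s t by (simp add: s'_def)
    moreover have "a' i \<in> M \<and> mball (a' i) s' \<subseteq> mball i r" if "i \<in> I" for i
      using a[rule_format, OF that] order_trans[OF a'[of i]] t by (simp add: a'_def)
    moreover have "b' j \<in> M \<and> mball (b' j) s' \<subseteq> mball j r" if "j \<in> J" for j
      using b[rule_format, OF that] order_trans[OF b'[of j]] t by (simp add: b'_def)
    ultimately show ?case
      by (intro exI[of _ a'] exI[of _ b'] exI[of _ s'] exI[of _ "max N N'"]) blast
  qed
  from this[of "I \<times> J"] show ?thesis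
    using fin by simp
qed

section \<open>Transfer from the hyperspace\<close>

interpretation H: Metric_space "compact_subsets M d" "hausdorff_dist M d"
  using Metric_space_axioms by (rule Metric_space_compact_subsets)

section \<open>The square of the hyperspace, finite sets, and balls around singletons\<close>

lemma completely_metrizable_space_compact_subsets:
  assumes "compact_space mtopology"
  shows "completely_metrizable_space (prod_topology H.mtopology H.mtopology)"
proof -
  have "completely_metrizable_space H.mtopology"
    using mcomplete_compact_subsets[OF assms] H.Metric_space_axioms
    unfolding completely_metrizable_space_def by blast
  then show ?thesis
    by (simp add: completely_metrizable_space_prod_topology)
qed

text \<open>Total boundedness gives a finite net; choosing it inside K makes the other half of the
  Hausdorff distance trivial.\<close>

lemma finite_approximation:
  assumes K: "K \<in> compact_subsets M d" and e: "e > 0"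
  shows "\<exists>F. finite F \<and> F \<subseteq> K \<and> F \<in> compact_subsets M d \<and> hausdorff_dist M d K F \<le> e"
proof -
  have "mtotally_bounded K"
    using compact_subsetsD(1)[OF K] by (rule compactin_imp_mtotally_bounded)
  then obtain F where F: "finite F" "F \<subseteq> K" "K \<subseteq> (\<Union>x\<in>F. mball x e)"
    unfolding mtotally_bounded_def using e by meson
  have FK: "F \<in> compact_subsets M d"
    using F compact_subsetsD[OF K] by (intro compact_subsets_finite) auto
  have "hausdorff_dist M d K F \<le> e"
  proof (rule hausdorff_dist_le[OF K FK])
    fix x assume "x \<in> K"
    then obtain i where "i \<in> F" "x \<in> mball i e" using F(3) by blast
    then show "\<exists>y\<in>F. d x y \<le> e"
      by (intro bexI[of _ i]) (auto simp: commute)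
  next
    fix y assume y: "y \<in> F"
    then have "y \<in> K" "y \<in> M" using F(2) compact_subsetsD[OF K] by auto
    then show "\<exists>x\<in>K. d x y \<le> e" using e by (intro bexI[of _ y]) auto
  qed
  with F FK show ?thesis by blast
qed

text \<open>The only possible nearby point in \<open>{u}\<close> is u. Thus pairs of sets near
  singletons have all their pairs of points in a box.\<close>

lemma in_mball_of_singleton:
  assumes K: "K \<in> H.mball {u} r" and p: "p \<in> K" and u: "u \<in> M"
  shows "p \<in> mball u r"
proof -
  have Kc: "K \<in> compact_subsets M d" and "hausdorff_dist M d K {u} < r"
    using K hausdorff_dist_commute[of K "{u}"] by (auto simp: H.in_mball)
  then have "\<exists>y\<in>{u}. d p y < r"
    using compact_subsets_finite[of "{u}"] u p by (intro hausdorff_dist_lessD[of K]) auto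
  then show ?thesis
    using u p compact_subsetsD[OF Kc] by (auto simp: commute)
qed

text \<open>Adding to K a point p near x moves K by at most \<open>d x p\<close>, so
  \<open>insert p K\<close> stays in the hyperspace ball around K and hence near the
  singleton.\<close>

lemma mball_subset_of_hyperspace_mball:
  assumes sub: "H.mball K r \<subseteq> H.mball {u} \<rho>" and K: "K \<in> compact_subsets M d"
    and x: "x \<in> K" and u: "u \<in> M"
  shows "mball x r \<subseteq> mball u \<rho>"
proof
  fix p assume "p \<in> mball x r"
  then have p: "p \<in> M" "d x p < r" by auto
  have "compactin mtopology ({p} \<union> K)"
    using p finite_imp_compactin[of "{p}" mtopology] by (intro compactin_Un compact_subsetsD(1)[OF K]) simp
  then have pK: "insert p K \<in> compact_subsets M d"
    by (simp add: compact_subsets_def)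
  have "hausdorff_dist M d K (insert p K) \<le> d x p"
  proof (rule hausdorff_dist_le[OF K pK])
    have refl: "d y y \<le> d x p" if "y \<in> K" for y
      using that compact_subsetsD[OF K] by (simp add: subset_iff)
    show "\<exists>y\<in>insert p K. d z y \<le> d x p" if "z \<in> K" for z
      using refl[OF that] that by blast
    show "\<exists>z\<in>K. d z y \<le> d x p" if "y \<in> insert p K" for y
      using refl that x by blast
  qed
  then have "insert p K \<in> H.mball K r"
    using p pK K by (simp add: H.in_mball)
  then show "p \<in> mball u \<rho>"
    using sub u by (intro in_mball_of_singleton[of "insert p K"]) auto
qed

text \<open>\<open>shrink_balls\<close> moves a pair of finite sets to centres of balls whose points
  have images eventually at distance at most c. Sets close to the moved finite sets lie in the
  unions of these balls, which bounds the Hausdorff distance of their images.\<close>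

lemma nowhere_dense_distal:
  assumes f: "continuous_map mtopology mtopology f" and u: "u \<in> M" and v: "v \<in> M"
    and shrink: "\<And>x y r. \<lbrakk>r > 0; x \<in> M; y \<in> M; mball x r \<subseteq> mball u \<rho>; mball y r \<subseteq> mball v \<rho>\<rbrakk> \<Longrightarrow>
      \<exists>x' y' s N. s > 0 \<and> x' \<in> M \<and> y' \<in> M \<and> mball x' s \<subseteq> mball x r \<and> mball y' s \<subseteq> mball y r \<and>
        (\<forall>p\<in>mball x' s. \<forall>q\<in>mball y' s. \<forall>n\<ge>N. d ((f ^^ n) p) ((f ^^ n) q) \<le> c)"
  shows "nowhere_dense_in (prod_topology H.mtopology H.mtopology)
    {(K, L). K \<in> H.mball {u} \<rho> \<and> L \<in> H.mball {v} \<rho> \<and>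
       (\<forall>N. \<exists>n\<ge>N. c < hausdorff_dist M d ((f ^^ n) ` K) ((f ^^ n) ` L))}"
    (is "nowhere_dense_in ?T ?E")
  unfolding nowhere_dense_in_iff
proof (intro conjI allI impI)
  show "?E \<subseteq> topspace ?T" by auto
next
  fix W assume W: "openin ?T W \<and> W \<noteq> {}"
  let ?B = "H.mball {u} \<rho> \<times> H.mball {v} \<rho>"
  have WB: "openin ?T (W \<inter> ?B)"
    using W by (intro openin_Int) (auto simp: openin_prod_Times_iff)
  show "\<exists>W'. openin ?T W' \<and> W' \<noteq> {} \<and> W' \<subseteq> W \<and> W' \<inter> ?E = {}"
  proof (cases "W \<inter> ?B = {}")
    case True
    then show ?thesis using W by (intro exI[of _ W]) auto
  next
    case False
    then obtain z where "z \<in> W \<inter> ?B" by blast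
    moreover obtain K L where "z = (K, L)" by (cases z)
    ultimately have KL: "(K, L) \<in> W \<inter> ?B" by blast
    then have K: "K \<in> compact_subsets M d" and L: "L \<in> compact_subsets M d" by auto
    obtain r where r: "r > 0" "H.mball K r \<times> H.mball L r \<subseteq> W \<inter> ?B"
      using WB KL unfolding H.openin_prod_mtopology by blast
    have "K \<in> H.mball K r" "L \<in> H.mball L r" using K L r by auto
    then have sub: "H.mball K r \<subseteq> H.mball {u} \<rho>" "H.mball L r \<subseteq> H.mball {v} \<rho>"
      using r(2) by blast+
    \<comment> \<open>The net costs r / 4 and moving its points at most r / 2, so the moved sets
      stay within r of K and L.\<close>
    obtain F where F: "finite F" "F \<subseteq> K" "F \<in> compact_subsets M d" "hausdorff_dist M d K F \<le> r / 4"
      using finite_approximation[OF K, of "r / 4"] r by auto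
    obtain G where G: "finite G" "G \<subseteq> L" "G \<in> compact_subsets M d" "hausdorff_dist M d L G \<le> r / 4"
      using finite_approximation[OF L, of "r / 4"] r by auto
    have half: "mball x (r / 2) \<subseteq> mball x r" for x
      using r by (intro mball_subset_concentric) simp
    have FM: "i \<in> M \<and> mball i (r / 2) \<subseteq> mball u \<rho>" if "i \<in> F" for i
      using that compact_subsetsD(2)[OF F(3)] F(2)
        order_trans[OF half[of i] mball_subset_of_hyperspace_mball[OF sub(1) K _ u, of i]] by blast
    have GM: "j \<in> M \<and> mball j (r / 2) \<subseteq> mball v \<rho>" if "j \<in> G" for j
      using that compact_subsetsD(2)[OF G(3)] G(2)
        order_trans[OF half[of j] mball_subset_of_hyperspace_mball[OF sub(2) L _ v, of j]] by blast
    have "r / 2 > 0" using r by simp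
    have "\<exists>a b s N. s > 0 \<and> (\<forall>i\<in>F. a i \<in> M \<and> mball (a i) s \<subseteq> mball i (r / 2)) \<and>
        (\<forall>j\<in>G. b j \<in> M \<and> mball (b j) s \<subseteq> mball j (r / 2)) \<and>
        (\<forall>i\<in>F. \<forall>j\<in>G. \<forall>p\<in>mball (a i) s. \<forall>q\<in>mball (b j) s. \<forall>n\<ge>N.
          d ((f ^^ n) p) ((f ^^ n) q) \<le> c)"
      by (rule shrink_balls[OF _ F(1) G(1) \<open>r / 2 > 0\<close> FM GM]) (rule shrink)
    then obtain a b s N where s: "s > 0"
      and a: "\<forall>i\<in>F. a i \<in> M \<and> mball (a i) s \<subseteq> mball i (r / 2)"
      and b: "\<forall>j\<in>G. b j \<in> M \<and> mball (b j) s \<subseteq> mball j (r / 2)"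
      and close: "\<forall>i\<in>F. \<forall>j\<in>G. \<forall>p\<in>mball (a i) s. \<forall>q\<in>mball (b j) s. \<forall>n\<ge>N.
        d ((f ^^ n) p) ((f ^^ n) q) \<le> c"
      by (elim exE conjE)
    have img: "h ` A \<in> compact_subsets M d \<and> h ` A \<in> H.mball K' r"
      if A: "finite A" "A \<in> compact_subsets M d" and K': "K' \<in> compact_subsets M d"
        and K'A: "hausdorff_dist M d K' A \<le> r / 4"
        and h: "\<forall>i\<in>A. h i \<in> M \<and> mball (h i) s \<subseteq> mball i (r / 2)" for h A K'
    proof -
      have hA: "h ` A \<in> compact_subsets M d"
        using A compact_subsetsD[OF A(2)] h by (intro compact_subsets_finite) auto
      have "d i (h i) \<le> r / 2" if "i \<in> A" for i
      proof -
        have "h i \<in> mball (h i) s" using h that s by simp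
        then have "h i \<in> mball i (r / 2)" using h that by blast
        then show ?thesis by simp
      qed
      then have "hausdorff_dist M d A (h ` A) \<le> r / 2"
        by (intro hausdorff_dist_le[OF A(2) hA]) blast+
      then have "hausdorff_dist M d K' (h ` A) < r"
        using H.triangle[OF K' A(2) hA] K'A r(1) by linarith
      then show ?thesis using hA K' by (simp add: H.in_mball)
    qed
    have aF: "a ` F \<in> compact_subsets M d" "a ` F \<in> H.mball K r"
      using img[OF F(1,3) K F(4) a] by auto
    have bG: "b ` G \<in> compact_subsets M d" "b ` G \<in> H.mball L r"
      using img[OF G(1,3) L G(4) b] by auto
    define W' where "W' = (H.mball (a ` F) s \<times> H.mball (b ` G) s) \<inter> (W \<inter> ?B)"
    have "openin ?T W'"
      unfolding W'_def by (rule openin_Int[OF _ WB]) (auto simp: openin_prod_Times_iff)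
    moreover have "(a ` F, b ` G) \<in> W'"
    proof -
      have "(a ` F, b ` G) \<in> H.mball (a ` F) s \<times> H.mball (b ` G) s"
        using aF bG s by simp
      moreover have "(a ` F, b ` G) \<in> W \<inter> ?B"
        using aF bG r(2) by blast
      ultimately show ?thesis unfolding W'_def by blast
    qed
    moreover have "W' \<inter> ?E = {}"
    proof -
      have near: "\<exists>i\<in>A. p \<in> mball (h i) s"
        if K': "K' \<in> H.mball (h ` A) s" and p: "p \<in> K'" for K' h A p
      proof -
        have "K' \<in> compact_subsets M d" "h ` A \<in> compact_subsets M d" "hausdorff_dist M d K' (h ` A) < s"
          using K' hausdorff_dist_commute[of K' "h ` A"] by (auto simp: H.in_mball)
        moreover from this obtain y where "y \<in> h ` A" "d p y < s"
          using hausdorff_dist_lessD p by blast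
        ultimately show ?thesis
          using p compact_subsetsD(2)[of K'] compact_subsetsD(2)[of "h ` A"]
          by (auto simp: commute subset_iff)
      qed
      have "\<not> c < hausdorff_dist M d ((f ^^ n) ` K') ((f ^^ n) ` L')"
        if KL': "(K', L') \<in> W'" and n: "n \<ge> N" for K' L' n
      proof -
        have K': "K' \<in> H.mball (a ` F) s" and L': "L' \<in> H.mball (b ` G) s"
          using KL' by (auto simp: W'_def)
        then have Kc: "K' \<in> compact_subsets M d" and Lc: "L' \<in> compact_subsets M d" by auto
        have *: "d ((f ^^ n) p) ((f ^^ n) q) \<le> c" if "p \<in> K'" "q \<in> L'" for p q
          using near[OF K' that(1)] near[OF L' that(2)] close n by blast
        \<comment> \<open>All distances between the two images are at most c, so any single point of
          the other set serves as a companion.\<close>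
        obtain p0 q0 where "p0 \<in> K'" "q0 \<in> L'"
          using compact_subsetsD(3)[OF Kc] compact_subsetsD(3)[OF Lc] by blast
        then have "hausdorff_dist M d ((f ^^ n) ` K') ((f ^^ n) ` L') \<le> c"
          using * by (intro hausdorff_dist_le funpow_image_compact_subsets[OF f] Kc Lc) blast+
        then show ?thesis by simp
      qed
      then show ?thesis by blast
    qed
    ultimately show ?thesis
      unfolding W'_def by blast
  qed
qed

text \<open>The chaotic pairs contain the intersection of a G-delta set, for the lower limit, with a
  countable union of G-delta sets, for the upper limit. The first complement is handled by picking
  points from chaotic pairs of sets, the second by contradiction.\<close>

lemma generically_chaotic_of_hyperspace:
  assumes comp: "compact_space mtopology" and f: "continuous_map mtopology mtopology f"
    and chaos: "generically_chaotic (compact_subsets M d) (hausdorff_dist M d) (\<lambda>K. f ` K) \<epsilon>"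
  shows "generically_chaotic M d f \<epsilon>"
proof -
  let ?T = "prod_topology mtopology mtopology" and ?TK = "prod_topology H.mtopology H.mtopology"
  define \<delta> where "\<delta> k = inverse (real (Suc k))" for k
  define D where "D n S = {(x, y). x \<in> M \<and> y \<in> M \<and> d ((f ^^ n) x) ((f ^^ n) y) \<in> S}" for n S
  \<comment> \<open>The index of P is a pair since both k and N are universally quantified; in Q
    they carry different quantifiers and stay separate.\<close>
  define P where "P = (\<lambda>(k, N). \<Union>n\<in>{N..}. D n {..<\<delta> k})"
  define Q where "Q k N = (\<Union>n\<in>{N..}. D n {\<epsilon> + \<delta> k<..})" for k N :: nat
  let ?C = "chaotic_pairs (compact_subsets M d) (hausdorff_dist M d) (\<lambda>K. f ` K) \<epsilon>"
  have openD: "openin ?T (D n S)" if "open S" for n S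
    using openin_dist_funpow[OF f that] by (simp add: D_def)
  have openP: "openin ?T (P i)" and openQ: "openin ?T (Q k N)" for i k N
    unfolding P_def Q_def by (auto simp: case_prod_beta intro!: openin_Union openD)
  have meets: "\<exists>p\<in>W. p \<in> ?C \<and> p \<notin> E" if "first_category_in ?TK E" "openin ?TK W" "W \<noteq> {}" for E W
    using chaos completely_metrizable_space_compact_subsets[OF comp] that
    unfolding generically_chaotic_def by (intro residual_in_meets_open) auto
  \<comment> \<open>An open set of pairs of points is probed in the hyperspace through a box around
    the singletons of one of its points.\<close>
  have boxes: "\<exists>u v \<rho>. \<rho> > 0 \<and> u \<in> M \<and> v \<in> M \<and> mball u \<rho> \<times> mball v \<rho> \<subseteq> W \<and>
      openin ?TK (H.mball {u} \<rho> \<times> H.mball {v} \<rho>) \<and> H.mball {u} \<rho> \<times> H.mball {v} \<rho> \<noteq> {}"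
    if W: "openin ?T W" "W \<noteq> {}" for W
  proof -
    obtain u v where uv: "(u, v) \<in> W" using W by auto
    then obtain \<rho> where \<rho>: "\<rho> > 0" "mball u \<rho> \<times> mball v \<rho> \<subseteq> W"
      using W unfolding openin_prod_mtopology by blast
    have M: "u \<in> M" "v \<in> M" using uv openin_subset[OF W(1)] by auto
    then have "{u} \<in> H.mball {u} \<rho>" "{v} \<in> H.mball {v} \<rho>"
      using \<rho> compact_subsets_finite[of "{u}"] compact_subsets_finite[of "{v}"] by auto
    then show ?thesis
      using \<rho> M by (intro exI[of _ u] exI[of _ v] exI[of _ \<rho>]) (auto simp: openin_prod_Times_iff)
  qed
  have "first_category_in ?T (topspace ?T - (\<Inter>i. P i))"
  proof (rule first_category_in_diff_INT_open_dense[OF openP])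
    fix i :: "nat \<times> nat" and W assume W: "openin ?T W" "W \<noteq> {}"
    obtain k N where i: "i = (k, N)" by (cases i)
    obtain u v \<rho> where uv: "\<rho> > 0" "u \<in> M" "v \<in> M" "mball u \<rho> \<times> mball v \<rho> \<subseteq> W"
      "openin ?TK (H.mball {u} \<rho> \<times> H.mball {v} \<rho>)" "H.mball {u} \<rho> \<times> H.mball {v} \<rho> \<noteq> {}"
      using boxes[OF W] by (elim exE conjE)
    \<comment> \<open>For the lower limit any chaotic pair of sets in the box will do, so the set to
      be avoided is empty.\<close>
    have "first_category_in ?TK {}"
      by (auto simp: first_category_in_def)
    then obtain K L where KL: "(K, L) \<in> ?C" "K \<in> H.mball {u} \<rho>" "L \<in> H.mball {v} \<rho>"
      using meets[OF _ uv(5,6)] by force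
    then have Kc: "K \<in> compact_subsets M d" and Lc: "L \<in> compact_subsets M d" by auto
    obtain n where n: "n \<ge> N" "hausdorff_dist M d ((f ^^ n) ` K) ((f ^^ n) ` L) < \<delta> k"
      using KL(1) unfolding H.chaotic_pairs_iff funpow_image \<delta>_def by blast
    obtain x where x: "x \<in> K" using compact_subsetsD(3)[OF Kc] by blast
    \<comment> \<open>Closeness of the images gives an arbitrary x in K a partner y in L; as x is
      near u and y near v, the pair lies in W.\<close>
    have "\<exists>z\<in>(f ^^ n) ` L. d ((f ^^ n) x) z < \<delta> k"
      using x by (intro hausdorff_dist_lessD[OF _ _ n(2)] funpow_image_compact_subsets[OF f] Kc Lc) auto
    then obtain y where y: "y \<in> L" "d ((f ^^ n) x) ((f ^^ n) y) < \<delta> k" by blast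
    have xy: "x \<in> mball u \<rho>" "y \<in> mball v \<rho>"
      using in_mball_of_singleton KL x y uv by blast+
    then have "(x, y) \<in> D n {..<\<delta> k}"
      using y(2) by (simp add: D_def)
    then have "(x, y) \<in> P i"
      using n(1) by (auto simp: P_def i)
    then show "W \<inter> P i \<noteq> {}"
      using xy uv(4) by blast
  qed
  moreover have "first_category_in ?T (topspace ?T - (\<Union>k. \<Inter>N. Q k N))"
  proof (rule first_category_in_diff_UN_INT[OF openQ], rule ccontr)
    fix W assume W: "openin ?T W" "W \<noteq> {}"
      and contr: "\<nexists>k W'. openin ?T W' \<and> W' \<noteq> {} \<and> W' \<subseteq> W \<and> (\<forall>N. W' \<subseteq> ?T closure_of Q k N)"
    obtain u v \<rho> where uv: "\<rho> > 0" "u \<in> M" "v \<in> M" "mball u \<rho> \<times> mball v \<rho> \<subseteq> W"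
      "openin ?TK (H.mball {u} \<rho> \<times> H.mball {v} \<rho>)" "H.mball {u} \<rho> \<times> H.mball {v} \<rho> \<noteq> {}"
      using boxes[OF W] by (elim exE conjE)
    define E where "E k = {(K, L). K \<in> H.mball {u} \<rho> \<and> L \<in> H.mball {v} \<rho> \<and>
       (\<forall>N. \<exists>n\<ge>N. \<epsilon> + \<delta> k < hausdorff_dist M d ((f ^^ n) ` K) ((f ^^ n) ` L))}" for k
    \<comment> \<open>The failure of local density on W becomes the shrinking hypothesis with c =
      \<epsilon> + \<delta> k.\<close>
    have "nowhere_dense_in ?TK (E k)" for k
      unfolding E_def
    proof (rule nowhere_dense_distal[OF f uv(2,3)])
      fix x y r
      assume r: "r > 0" and M: "x \<in> M" "y \<in> M" and sub: "mball x r \<subseteq> mball u \<rho>" "mball y r \<subseteq> mball v \<rho>"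
      let ?B = "mball x r \<times> mball y r"
      have B: "openin ?T ?B" "?B \<noteq> {}" "?B \<subseteq> W"
        using r M sub uv(4) by (auto simp: openin_prod_Times_iff)
      \<comment> \<open>Some \<open>Q k N\<close> is not dense in the box; a smaller box avoids its
        closure, so there all distances from time N on are at most \<epsilon> + \<delta> k.\<close>
      then obtain N where N: "\<not> ?B \<subseteq> ?T closure_of Q k N"
        using contr by blast
      have "openin ?T (?B - ?T closure_of Q k N)"
        using B(1) by (intro openin_diff) auto
      then obtain x' y' s where xy: "x' \<in> M" "y' \<in> M" and s: "s > 0"
        "mball x' s \<times> mball y' s \<subseteq> ?B - ?T closure_of Q k N"
        using N boxes[of "?B - ?T closure_of Q k N"] by blast
      have "x' \<in> mball x' s" "y' \<in> mball y' s" using xy s by auto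
      then have "mball x' s \<subseteq> mball x r" "mball y' s \<subseteq> mball y r" using s(2) by blast+
      moreover have "d ((f ^^ n) p) ((f ^^ n) q) \<le> \<epsilon> + \<delta> k"
        if pq: "p \<in> mball x' s" "q \<in> mball y' s" and n: "n \<ge> N" for p q n
      proof -
        have "(p, q) \<notin> Q k N"
          using s(2) pq closure_of_subset[OF openin_subset[OF openQ], of k N] by blast
        then have "(p, q) \<notin> D n {\<epsilon> + \<delta> k<..}"
          using n by (auto simp: Q_def)
        then show ?thesis
          using pq by (simp add: D_def not_less)
      qed
      ultimately show "\<exists>x' y' s N. s > 0 \<and> x' \<in> M \<and> y' \<in> M \<and> mball x' s \<subseteq> mball x r \<and>
          mball y' s \<subseteq> mball y r \<and>
          (\<forall>p\<in>mball x' s. \<forall>q\<in>mball y' s. \<forall>n\<ge>N. d ((f ^^ n) p) ((f ^^ n) q) \<le> \<epsilon> + \<delta> k)"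
        using xy s(1) by (intro exI[of _ x'] exI[of _ y'] exI[of _ s] exI[of _ N]) simp
    qed
    then have "first_category_in ?TK (\<Union>k. E k)"
      by (intro first_category_in_UN nowhere_dense_imp_first_category) auto
    \<comment> \<open>Lying outside every \<open>E k\<close> excludes every margin above \<epsilon>,
      although the upper limit for a chaotic pair exceeds \<epsilon>.\<close>
    from meets[OF this uv(5,6)] obtain K L
      where KL: "(K, L) \<in> ?C" "K \<in> H.mball {u} \<rho>" "L \<in> H.mball {v} \<rho>" "\<And>k. (K, L) \<notin> E k"
      by force
    obtain k where "\<forall>N. \<exists>n\<ge>N. \<epsilon> + \<delta> k < hausdorff_dist M d ((f ^^ n) ` K) ((f ^^ n) ` L)"
      using KL(1) unfolding H.chaotic_pairs_iff funpow_image \<delta>_def by blast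
    then show False
      using KL(2,3) KL(4)[of k] by (simp add: E_def)
  qed
  moreover have "topspace ?T \<inter> (\<Inter>i. P i) \<inter> (\<Union>k. \<Inter>N. Q k N) \<subseteq> chaotic_pairs M d f \<epsilon>"
  proof
    fix z
    assume z: "z \<in> topspace ?T \<inter> (\<Inter>i. P i) \<inter> (\<Union>k. \<Inter>N. Q k N)"
    obtain x y where xy: "z = (x, y)" by (cases z)
    have "x \<in> M" "y \<in> M" using z xy by auto
    moreover have "\<exists>n\<ge>N. d ((f ^^ n) x) ((f ^^ n) y) < \<delta> k" for k N
    proof -
      have "z \<in> P (k, N)" using z by blast
      then show ?thesis by (auto simp: P_def D_def xy)
    qed
    moreover obtain k where k: "\<And>N. z \<in> Q k N" using z by blast
    have "\<exists>n\<ge>N. \<epsilon> + \<delta> k < d ((f ^^ n) x) ((f ^^ n) y)" for N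
      using k[of N] by (auto simp: Q_def D_def xy)
    ultimately show "z \<in> chaotic_pairs M d f \<epsilon>"
      unfolding xy chaotic_pairs_iff \<delta>_def by blast
  qed
  then have "topspace ?T - chaotic_pairs M d f \<epsilon> \<subseteq>
      (topspace ?T - (\<Inter>i. P i)) \<union> (topspace ?T - (\<Union>k. \<Inter>N. Q k N))"
    by blast
  ultimately have "first_category_in ?T (topspace ?T - chaotic_pairs M d f \<epsilon>)"
    by (meson first_category_in_Un first_category_in_subset)
  moreover have "chaotic_pairs M d f \<epsilon> \<subseteq> topspace ?T"
    by (auto simp: chaotic_pairs_def)
  ultimately show ?thesis
    by (simp add: generically_chaotic_def residual_in_def)
qed

end

theorem corollary3p3:
  fixes X :: "'a set" and d :: "'a \<Rightarrow> 'a \<Rightarrow> real" and f :: "'a \<Rightarrow> 'a" and \<epsilon> :: real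
  assumes "Metric_space X d"
    and "compact_space (Metric_space.mtopology X d)"
    and "continuous_map (Metric_space.mtopology X d) (Metric_space.mtopology X d) f"
    and "\<epsilon> > 0"
    and "generically_chaotic (compact_subsets X d) (hausdorff_dist X d) (\<lambda>K. f ` K) \<epsilon>"
  shows "generically_chaotic X d f \<epsilon>"
  by (rule Metric_space.generically_chaotic_of_hyperspace[OF assms(1,2,3,5)])

end
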